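(* Let $1 \leq m \leq n$ and let $K_{m,n}$ be the complete bipartite graph with parts of sizes $m$ and $n$. Then $\chi_s(S(K_{m,n})) = 2m+1$.
   Context: All graphs are finite, simple and undirected. A star coloring of a graph $G$ is a proper vertex coloring of $G$ in which every path on four vertices uses at least three distinct colors. The star chromatic number $\chi_s(G)$ is the least number of colors in a star coloring of $G$. The splitting graph $S(G)$ of a graph $G$ is obtained from $G$ by adding, for each vertex $v$ of $G$, a new vertex $v'$ whose neighborhood is $N(v')=N(v)$, the neighborhood of $v$ in $G$ (the new vertices are pairwise nonadjacent). *)

theory Defs
  imports "Graph_Theory.Graph_Theory"
begin

text \<open>
  Finite simple undirected graphs are the symmetric, loop-free digraphs without multiple arcs of
  locale \<^locale>\<open>graph\<close>; adjacency of \<open>u\<close> and \<open>v\<close> is \<open>(u, v) \<in> arcs_ends G\<close>.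
\<close>

definition proper_coloring :: "('a, 'b) pre_digraph \<Rightarrow> ('a \<Rightarrow> 'c) \<Rightarrow> bool" where
  "proper_coloring G c \<longleftrightarrow> (\<forall>(u, v) \<in> arcs_ends G. c u \<noteq> c v)"

definition star_coloring :: "('a, 'b) pre_digraph \<Rightarrow> ('a \<Rightarrow> 'c) \<Rightarrow> bool" where
  "star_coloring G c \<longleftrightarrow> proper_coloring G c \<and>
     (\<forall>p. vpath p G \<and> length p = 4 \<longrightarrow> 3 \<le> card (c ` set p))"

text \<open>
  Only the values of a coloring on \<open>verts G\<close> matter. Natural numbers are enough as colors, since
  graphs are finite; on an infinite vertex set the definition below is not meaningful, as
  \<^const>\<open>card\<close> is 0 on infinite sets.
\<close>

definition star_chromatic_number :: "('a, 'b) pre_digraph \<Rightarrow> nat" where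
  "star_chromatic_number G =
     (LEAST k. \<exists>c :: 'a \<Rightarrow> nat. star_coloring G c \<and> card (c ` verts G) = k)"

text \<open>The original vertex \<open>v\<close> is \<open>Inl v\<close>, and its added copy is \<open>Inr v\<close>.\<close>

definition splitting_graph ::
    "('a, 'b) pre_digraph \<Rightarrow> ('a + 'a, ('a + 'a) \<times> ('a + 'a)) pre_digraph" where
  "splitting_graph G = with_proj
     \<lparr> pverts = verts G <+> verts G,
       parcs = (\<Union>(u, v) \<in> arcs_ends G. {(Inl u, Inl v), (Inl u, Inr v), (Inr u, Inl v)}) \<rparr>"

lemma verts_splitting_graph [simp]: "verts (splitting_graph G) = verts G <+> verts G"
  by (simp add: splitting_graph_def)

lemma arcs_ends_splitting_graph:
  "arcs_ends (splitting_graph G) =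
     (\<Union>(u, v) \<in> arcs_ends G. {(Inl u, Inl v), (Inl u, Inr v), (Inr u, Inl v)})"
  by (simp add: splitting_graph_def)

lemma (in graph) graph_splitting_graph: "graph (splitting_graph G)"
proof -
  have fin: "finite (arcs_ends G)"
    by (simp add: arcs_ends_def)
  have s: "(v, u) \<in> arcs_ends G" if "(u, v) \<in> arcs_ends G" for u v
    using that sym_arcs by (rule arcs_ends_symmetric[rotated])
  have w: "u \<in> verts G" "v \<in> verts G" "u \<noteq> v" if "(u, v) \<in> arcs_ends G" for u v
    using that no_loops by (auto simp: arcs_ends_conv)
  have "pair_graph
     \<lparr> pverts = verts G <+> verts G,
       parcs = (\<Union>(u, v) \<in> arcs_ends G. {(Inl u, Inl v), (Inl u, Inr v), (Inr u, Inl v)}) \<rparr>"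
    by unfold_locales
      (use fin w in \<open>auto simp: symmetric_def intro!: symI dest: s\<close>)
  then interpret H: pair_graph
    "\<lparr> pverts = verts G <+> verts G,
       parcs = (\<Union>(u, v) \<in> arcs_ends G. {(Inl u, Inl v), (Inl u, Inr v), (Inr u, Inl v)}) \<rparr>" .
  show ?thesis
    unfolding splitting_graph_def by (rule H.graph_axioms)
qed

lemma (in graph) ex_star_coloring: "\<exists>c :: 'a \<Rightarrow> nat. star_coloring G c"
proof -
  obtain c :: "'a \<Rightarrow> nat" where c: "inj_on c (verts G)"
    using finite_imp_inj_to_nat_seg[OF finite_verts] by blast
  have "proper_coloring G c"
    using c no_loops wellformed by (fastforce simp: proper_coloring_def arcs_ends_conv inj_on_def)
  moreover have "3 \<le> card (c ` set p)" if p: "vpath p G" "length p = 4" for p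
  proof -
    have "set p \<subseteq> verts G" "distinct p"
      using p(1) by (auto simp: vpath_def vwalk_def)
    then have "card (c ` set p) = 4"
      using c p(2) by (metis card_image distinct_card inj_on_subset)
    then show ?thesis by simp
  qed
  ultimately show ?thesis
    by (auto simp: star_coloring_def)
qed

end

theory Submission
  imports Defs
begin

text \<open>
  Write \<open>U, V\<close> for the parts of \<open>K\<^bsub>m,n\<^esub>\<close> and \<open>U', V'\<close> for their copies. Coloring \<open>U \<union> U'\<close>
  injectively and \<open>V \<union> V'\<close> with one further color uses \<open>2m + 1\<close> colors, and it is a star coloring
  since a path on four vertices has two vertices on either side.
  Conversely, two vertices of the same color force their common neighbors to have distinct colors.
  So a repeated color on \<open>U\<close> gives \<open>2n + 1\<close> colors and a repeated color on \<open>V\<close> gives \<open>2m + 1\<close>.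
  If colors repeat neither on \<open>U\<close> nor on \<open>V\<close>, then \<open>U \<union> V\<close> has \<open>m + n\<close> colors, and there is another
  one: otherwise \<open>u' \<in> U'\<close> shares its color with some \<open>u \<in> U\<close> and \<open>v' \<in> V'\<close> with some \<open>v \<in> V\<close>, and
  the path \<open>u', v, u, v'\<close> has only two colors.
\<close>

lemma proper_coloringD:
  assumes "proper_coloring G c" and "(u, v) \<in> arcs_ends G"
  shows "c u \<noteq> c v"
  using assms by (auto simp: proper_coloring_def)

lemma (in wf_digraph) star_coloring_not_bicolored:
  assumes c: "star_coloring G c"
    and arcs: "(x, y) \<in> arcs_ends G" "(y, z) \<in> arcs_ends G" "(z, w) \<in> arcs_ends G"
    and dist: "distinct [x, y, z, w]"
    and xz: "c x = c z"
  shows "c y \<noteq> c w"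
proof
  assume "c y = c w"
  then have "c ` set [x, y, z, w] = {c z, c w}"
    using xz by auto
  then have "card (c ` set [x, y, z, w]) \<le> 2"
    by (simp add: card_insert_if)
  moreover have "vpath [x, y, z, w] G"
    using arcs dist by (auto simp: vpath_def vwalk_def arcs_ends_conv)
  then have "3 \<le> card (c ` set [x, y, z, w])"
    using c by (auto simp: star_coloring_def simp del: set_simps)
  ultimately show False by simp
qed

text \<open>If \<open>x\<close> and \<open>y\<close> in \<open>W\<close> shared a color, the path
  \<open>x, a, y, b\<close> would have only two colors. So \<open>c\<close> is injective on
  \<open>W\<close>, and the color of \<open>a\<close>, absent from \<open>W\<close> by properness,
  is the extra one.\<close>

lemma (in graph) star_coloring_card_common_neighbors:
  assumes c: "star_coloring G c"
    and ab: "a \<noteq> b" "c a = c b"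
    and W: "\<And>w. w \<in> W \<Longrightarrow> (a, w) \<in> arcs_ends G \<and> (b, w) \<in> arcs_ends G"
    and a: "a \<in> verts G"
  shows "card W + 1 \<le> card (c ` verts G)"
proof -
  have sub: "W \<subseteq> verts G"
    using W adj_in_verts(2) by (meson subsetI)
  have proper: "proper_coloring G c"
    using c by (simp add: star_coloring_def)
  have ne: "c a \<noteq> c w" "c b \<noteq> c w" if "w \<in> W" for w
    using W[OF that] proper_coloringD[OF proper] by blast+
  have "inj_on c W"
  proof (rule inj_onI, rule ccontr)
    fix x y assume xy: "x \<in> W" "y \<in> W" "c x = c y" "x \<noteq> y"
    have "(x, a) \<in> arcs_ends G"
      using W[OF xy(1)] sym_arcs by (blast intro: arcs_ends_symmetric)
    moreover have "(y, b) \<in> arcs_ends G"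
      using W[OF xy(2)] sym_arcs by (blast intro: arcs_ends_symmetric)
    \<comment> \<open>Properness separates \<open>x\<close> and \<open>y\<close> from
      \<open>a\<close> and \<open>b\<close>, as their colors differ.\<close>
    moreover have "distinct [x, a, y, b]"
      using ab(1) xy(4) ne[OF xy(1)] ne[OF xy(2)] by auto
    ultimately show False
      using star_coloring_not_bicolored[OF c, of x a y b] W[OF xy(2)] xy(3) ab(2) by blast
  qed
  then have "card (c ` W) = card W"
    by (rule card_image)
  moreover have "c a \<notin> c ` W"
    using ne by auto
  moreover have "finite W"
    using sub finite_verts finite_subset by blast
  ultimately have "card (c ` insert a W) = card W + 1"
    by simp
  moreover have "card (c ` insert a W) \<le> card (c ` verts G)"
    using sub a by (intro card_mono) auto
  ultimately show ?thesis by simp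
qed

lemma star_coloring_bipartite:
  assumes bip: "\<And>x y. (x, y) \<in> arcs_ends G \<Longrightarrow> x \<in> A \<longleftrightarrow> y \<notin> A"
    and inj: "inj_on c A"
    and const: "\<And>x. x \<notin> A \<Longrightarrow> c x = k"
    and k: "k \<notin> c ` A"
  shows "star_coloring G c"
  unfolding star_coloring_def
proof (intro conjI allI impI)
  have ne: "c x \<noteq> c y" if "x \<in> A \<longleftrightarrow> y \<notin> A" for x y
    using that const k by (metis imageI)
  then show "proper_coloring G c"
    using bip by (auto simp: proper_coloring_def)
  fix p assume p: "vpath p G \<and> length p = 4"
  then obtain x y z w where pw: "p = [x, y, z, w]"
    by (auto simp: length_Suc_conv eval_nat_numeral)
  have arcs: "(x, y) \<in> arcs_ends G" "(y, z) \<in> arcs_ends G" "(z, w) \<in> arcs_ends G"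
    and dist: "x \<noteq> z" "y \<noteq> w"
    using p by (auto simp: pw vpath_def vwalk_def)
  note sides = bip[OF arcs(1)] bip[OF arcs(2)] bip[OF arcs(3)]
  \<comment> \<open>The sides alternate along \<open>p\<close>, so \<open>x\<close>,
    \<open>z\<close> or else \<open>y\<close>, \<open>w\<close> lie in \<open>A\<close>. Together
    with the vertex between them they carry three colors.\<close>
  obtain S where S: "S \<subseteq> set p" "card (c ` S) = 3"
  proof (cases "x \<in> A")
    case True
    then have "c x \<noteq> c z"
      using sides dist inj by (auto dest: inj_onD)
    then have "card (c ` {x, y, z}) = 3"
      using sides ne by simp
    then show thesis
      by (intro that[of "{x, y, z}"]) (auto simp: pw)
  next
    case False
    then have "c y \<noteq> c w"
      using sides dist inj by (auto dest: inj_onD)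
    then have "card (c ` {y, z, w}) = 3"
      using sides ne by simp
    then show thesis
      by (intro that[of "{y, z, w}"]) (auto simp: pw)
  qed
  then show "3 \<le> card (c ` set p)"
    by (metis card_mono finite_imageI finite_set image_mono)
qed

text \<open>This form shows the common neighborhoods directly: all of \<open>Inl\<close>
  U\<open>is joined to\<close>V <+> V\<open>, and all of\<close>Inl \<open>V\<close> to
  \<open>U <+> U\<close>.\<close>

lemma arcs_ends_splitting_graph_bipartite:
  assumes "arcs_ends G = U \<times> V \<union> V \<times> U"
  shows "arcs_ends (splitting_graph G) =
    (Inl ` U) \<times> (V <+> V) \<union> (V <+> V) \<times> (Inl ` U) \<union> (Inl ` V) \<times> (U <+> U) \<union> (U <+> U) \<times> (Inl ` V)"
  by (auto simp: arcs_ends_splitting_graph assms)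

lemma ex_star_coloring_splitting_graph_bipartite:
  assumes verts: "verts G = U \<union> V" and arcs: "arcs_ends G = U \<times> V \<union> V \<times> U"
    and UV: "U \<inter> V = {}" and fin: "finite U" and V: "V \<noteq> {}"
  shows "\<exists>c :: 'a + 'a \<Rightarrow> nat. star_coloring (splitting_graph G) c \<and>
    card (c ` verts (splitting_graph G)) = 2 * card U + 1"
proof -
  define A where "A = U <+> U"
  define k where "k = 2 * card U"
  have "finite A" "card A = k"
    using fin by (auto simp: A_def k_def card_Plus)
  then obtain h where h: "bij_betw h A {0..<k}"
    using ex_bij_betw_finite_nat[of A] by blast
  \<comment> \<open>The values of \<open>h\<close> on \<open>A\<close> are exactly the numbers below
    \<open>k\<close>, so \<open>k\<close> is a fresh color.\<close>
  define c where "c x = (if x \<in> A then h x else k)" for x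
  have img: "c ` A = {0..<k}"
    using h by (simp add: c_def bij_betw_def)
  have "star_coloring (splitting_graph G) c"
  proof (rule star_coloring_bipartite)
    show "x \<in> A \<longleftrightarrow> y \<notin> A" if "(x, y) \<in> arcs_ends (splitting_graph G)" for x y
      using that UV by (auto simp: arcs_ends_splitting_graph arcs A_def)
    show "inj_on c A"
      using h by (simp add: c_def bij_betw_def inj_on_def)
    show "c x = k" if "x \<notin> A" for x
      using that by (simp add: c_def)
    show "k \<notin> c ` A"
      by (simp add: img)
  qed
  moreover have "c ` (V <+> V) = {k}"
    \<comment> \<open>Since \<open>V\<close> is nonempty, the color \<open>k\<close> really occurs,
      which makes the count exact.\<close>
    using V UV by (force simp: c_def A_def)
  then have "c ` verts (splitting_graph G) = insert k {0..<k}"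
    using img by (auto simp: verts A_def)
  then have "card (c ` verts (splitting_graph G)) = 2 * card U + 1"
    by (simp add: k_def)
  ultimately show ?thesis by blast
qed

text \<open>The \<open>min\<close> keeps the statement symmetric in \<open>U\<close> and
  \<open>V\<close>: a repeated color on one part yields a bound by twice the size of the
  other.\<close>

lemma card_star_coloring_splitting_graph_bipartite:
  assumes G: "graph G" and verts: "verts G = U \<union> V" and arcs: "arcs_ends G = U \<times> V \<union> V \<times> U"
    and UV: "U \<inter> V = {}" and U: "U \<noteq> {}" and V: "V \<noteq> {}"
    and c: "star_coloring (splitting_graph G) c"
  shows "2 * min (card U) (card V) + 1 \<le> card (c ` verts (splitting_graph G))"
proof -
  interpret G: graph G by (rule G)
  interpret S: graph "splitting_graph G" by (rule G.graph_splitting_graph)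
  let ?C = "c ` verts (splitting_graph G)"
  note arcsS = arcs_ends_splitting_graph_bipartite[OF arcs]
  have fin: "finite U" "finite V"
    using G.finite_verts by (auto simp: verts)
  show ?thesis
  proof (cases "inj_on (c \<circ> Inl) U \<and> inj_on (c \<circ> Inl) V")
    case True
    let ?CU = "(c \<circ> Inl) ` U" and ?CV = "(c \<circ> Inl) ` V"
    have proper: "c x \<noteq> c y" if "(x, y) \<in> arcs_ends (splitting_graph G)" for x y
      by (rule proper_coloringD[OF _ that]) (use c in \<open>simp add: star_coloring_def\<close>)
    have "c (Inl u) \<noteq> c (Inl v)" if "u \<in> U" "v \<in> V" for u v
      by (rule proper) (use that in \<open>auto simp: arcsS\<close>)
    then have "?CU \<inter> ?CV = {}"
      by fastforce
    then have card: "card (?CU \<union> ?CV) = card U + card V"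
      using True fin by (metis card_Un_disjoint card_image finite_imageI)
    have "\<not> ?C \<subseteq> ?CU \<union> ?CV"
    proof
      assume sub: "?C \<subseteq> ?CU \<union> ?CV"
      obtain a b where ab: "a \<in> U" "b \<in> V"
        using U V by blast
      \<comment> \<open>Properness keeps the color of \<open>Inr a\<close> off \<open>?CV\<close>
        and that of \<open>Inr b\<close> off \<open>?CU\<close>, so they must recur on
        \<open>U\<close> and on \<open>V\<close> respectively.\<close>
      have "c (Inr a) \<noteq> c (Inl v)" if "v \<in> V" for v
        by (rule proper) (use ab that in \<open>auto simp: arcsS\<close>)
      moreover have "c (Inr b) \<noteq> c (Inl u)" if "u \<in> U" for u
        by (rule proper) (use ab that in \<open>auto simp: arcsS\<close>)
      moreover have "Inr a \<in> verts (splitting_graph G)" "Inr b \<in> verts (splitting_graph G)"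
        using ab by (auto simp: verts)
      then have "c (Inr a) \<in> ?CU \<union> ?CV" "c (Inr b) \<in> ?CU \<union> ?CV"
        using sub by blast+
      ultimately obtain u v where uv: "u \<in> U" "c (Inr a) = c (Inl u)" "v \<in> V" "c (Inr b) = c (Inl v)"
        unfolding image_def comp_def by blast
      have "c (Inl v) \<noteq> c (Inr b)"
      proof (rule S.star_coloring_not_bicolored[OF c])
        show "(Inr a, Inl v) \<in> arcs_ends (splitting_graph G)"
          "(Inl v, Inl u) \<in> arcs_ends (splitting_graph G)"
          "(Inl u, Inr b) \<in> arcs_ends (splitting_graph G)"
          using ab uv by (auto simp: arcsS)
        show "distinct [Inr a, Inl v, Inl u, Inr b]"
          using ab uv UV by auto
      qed (rule uv)
      then show False using uv by simp
    qed
    moreover have "?CU \<union> ?CV \<subseteq> ?C"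
      by (auto simp: verts)
    ultimately have "?CU \<union> ?CV \<subset> ?C"
      by blast
    then have "card (?CU \<union> ?CV) < card ?C"
      by (rule psubset_card_mono[OF finite_imageI[OF S.finite_verts]])
    then show ?thesis
      using card by linarith
  next
    case False
    then consider (U) u1 u2 where "u1 \<in> U" "u2 \<in> U" "u1 \<noteq> u2" "c (Inl u1) = c (Inl u2)"
      | (V) v1 v2 where "v1 \<in> V" "v2 \<in> V" "v1 \<noteq> v2" "c (Inl v1) = c (Inl v2)"
      by (auto simp: inj_on_def)
    then show ?thesis
    proof cases
      case U
      then have "card (V <+> V) + 1 \<le> card ?C"
        by (intro S.star_coloring_card_common_neighbors[OF c, of "Inl u1" "Inl u2"])
          (auto simp: arcsS verts)
      then show ?thesis
        using fin by (simp add: card_Plus)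
    next
      case V
      then have "card (U <+> U) + 1 \<le> card ?C"
        by (intro S.star_coloring_card_common_neighbors[OF c, of "Inl v1" "Inl v2"])
          (auto simp: arcsS verts)
      then show ?thesis
        using fin by (simp add: card_Plus)
    qed
  qed
qed

theorem theorem4:
  fixes m n :: nat and G :: "('a, 'b) pre_digraph"
  assumes "1 \<le> m" and "m \<le> n"
    and "K\<^bsub>m,n\<^esub> G"
  shows "star_chromatic_number (splitting_graph G) = 2 * m + 1"
proof -
  obtain U V where G: "graph G" and verts: "verts G = U \<union> V" and UV: "U \<inter> V = {}"
    and card: "card U = m" "card V = n" and arcs: "arcs_ends G = U \<times> V \<union> V \<times> U"
    using assms(3) unfolding complete_bipartite_digraph_def by blast
  \<comment> \<open>Positive cardinality gives finiteness as well, since \<open>card\<close> is 0 on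
    infinite sets.\<close>
  have ne: "U \<noteq> {}" "V \<noteq> {}" and fin: "finite U"
    using card assms(1,2) by (auto intro: card_ge_0_finite)
  show ?thesis
    unfolding star_chromatic_number_def
  proof (rule Least_equality)
    show "\<exists>c :: 'a + 'a \<Rightarrow> nat. star_coloring (splitting_graph G) c \<and>
        card (c ` verts (splitting_graph G)) = 2 * m + 1"
      using ex_star_coloring_splitting_graph_bipartite[OF verts arcs UV fin ne(2)] card by simp
  next
    fix k
    assume "\<exists>c :: 'a + 'a \<Rightarrow> nat. star_coloring (splitting_graph G) c \<and>
        card (c ` verts (splitting_graph G)) = k"
    \<comment> \<open>Here \<open>m \<le> n\<close> turns the \<open>min\<close> of the lower bound
      into \<open>m\<close>.\<close>
    then show "2 * m + 1 \<le> k"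
      using card_star_coloring_splitting_graph_bipartite[OF G verts arcs UV ne] card assms(2)
      by fastforce
  qed
qed

end
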